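(* Let $\mathcal L\in\{\mathbf{nbIciw},\mathbf{nbIci},\mathbf{nbIcl}\}$. For every set of formulas $\Gamma\cup\{\varphi\}\subseteq \mathbf{F}(\Sigma_{\mathbf{nbI}},\mathcal V)$: if $\Gamma\vdash_{\mathcal L}\varphi$ then $\Gamma\vDash_{\mathcal L}\varphi$.
   Context: Let $\mathcal V$ be a countable set of propositional variables and $\Sigma_{\mathbf{nbI}}=\{\vee,\wedge,\rightarrow,\uparrow,\neg\}$ with $\neg$ unary and the other connectives binary; $\mathbf F(\Sigma_{\mathbf{nbI}},\mathcal V)$ is the set of formulas. The logic $\mathbf{nbI}$ is the Hilbert calculus whose only inference rule is Modus Ponens and whose axioms are all instances (with arbitrary formulas) of: (1) $\alpha\to(\beta\to\alpha)$; (2) $(\alpha\to(\beta\to\gamma))\to((\alpha\to\beta)\to(\alpha\to\gamma))$; (3) $\alpha\to(\beta\to(\alpha\wedge\beta))$; (4) $(\alpha\wedge\beta)\to\alpha$; (5) $(\alpha\wedge\beta)\to\beta$; (6) $\alpha\to(\alpha\vee\beta)$; (7) $\beta\to(\alpha\vee\beta)$; (8) $(\alpha\to\gamma)\to((\beta\to\gamma)\to((\alpha\vee\beta)\to\gamma))$; (9) $(\alpha\to\beta)\vee\alpha$; (Ip) $(\alpha\uparrow\beta)\to(\alpha\to(\beta\to\gamma))$; (Comm) $(\alpha\uparrow\beta)\to(\beta\uparrow\alpha)$; (11) $\alpha\vee\neg\alpha$. The logics $\mathbf{nbIciw}$, $\mathbf{nbIci}$, $\mathbf{nbIcl}$ are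 obtained from $\mathbf{nbI}$ by adding, respectively, all instances of $(\alpha\uparrow\neg\alpha)\vee(\alpha\wedge\neg\alpha)$; of $\neg(\alpha\uparrow\neg\alpha)\to(\alpha\wedge\neg\alpha)$; of $\neg(\alpha\wedge\neg\alpha)\to(\alpha\uparrow\neg\alpha)$. $\Gamma\vdash_{\mathcal L}\varphi$ means that there is a finite derivation of $\varphi$ from premises in $\Gamma$ in the calculus of $\mathcal L$. A bivaluation for $\mathbf{nbI}$ is a map $\nu:\mathbf F(\Sigma_{\mathbf{nbI}},\mathcal V)\to\{0,1\}$ such that for all formulas $\alpha,\beta$: $\nu(\alpha\vee\beta)=1$ iff $\nu(\alpha)=1$ or $\nu(\beta)=1$; $\nu(\alpha\wedge\beta)=1$ iff $\nu(\alpha)=\nu(\beta)=1$; $\nu(\alpha\to\beta)=1$ iff $\nu(\alpha)=0$ or $\nu(\beta)=1$; if $\nu(\alpha\uparrow\beta)=1$ then $\nu(\alpha)=0$ or $\nu(\beta)=0$; $\nu(\alpha\uparrow\beta)=\nu(\beta\uparrow\alpha)$; if $\nu(\neg\alpha)=0$ then $\nu(\alpha)=1$. A bivaluation for $\mathcal L$ is a bivaluation $\nu$ for $\mathbf{nbI}$ such that for all $\alpha$: if $\nu(\alpha\uparrow\neg\alpha)=0$ then $\nu(\alpha)=\nu(\neg\alpha)=1$; if $\mathcal L=\mathbf{nbIci}$, moreover, $\nu(\neg(\alpha\uparrow\neg\alpha))=1$ implies $\nu(\alpha)=\nu(\neg\alpha)=1$; if $\mathcal L=\mathbf{nbIcl}$,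 moreover, $\nu(\neg(\alpha\wedge\neg\alpha))=1$ implies $\nu(\alpha\uparrow\neg\alpha)=1$. $\Gamma\vDash_{\mathcal L}\varphi$ means: for every bivaluation $\nu$ for $\mathcal L$, if $\nu(\gamma)=1$ for all $\gamma\in\Gamma$ then $\nu(\varphi)=1$. *)

theory Defs
  imports Main "HOL-Library.Countable"
begin

text \<open>Propositional variables are the elements of an arbitrary countable type.\<close>

datatype 'v fm =
    Var 'v
  | Neg "'v fm"
  | Or "'v fm" "'v fm"  (infixr \<open>\<^bold>\<or>\<close> 65)
  | And "'v fm" "'v fm"  (infixr \<open>\<^bold>\<and>\<close> 70)
  | Imp "'v fm" "'v fm"  (infixr \<open>\<^bold>\<rightarrow>\<close> 60)
  | Inc "'v fm" "'v fm"  (infix \<open>\<^bold>\<up>\<close> 75)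

notation Neg  (\<open>\<^bold>\<not> _\<close> [80] 80)

inductive nbI_axiom :: "'v fm \<Rightarrow> bool" where
  Ax1: "nbI_axiom (\<alpha> \<^bold>\<rightarrow> (\<beta> \<^bold>\<rightarrow> \<alpha>))"
| Ax2: "nbI_axiom ((\<alpha> \<^bold>\<rightarrow> (\<beta> \<^bold>\<rightarrow> \<gamma>)) \<^bold>\<rightarrow> ((\<alpha> \<^bold>\<rightarrow> \<beta>) \<^bold>\<rightarrow> (\<alpha> \<^bold>\<rightarrow> \<gamma>)))"
| Ax3: "nbI_axiom (\<alpha> \<^bold>\<rightarrow> (\<beta> \<^bold>\<rightarrow> (\<alpha> \<^bold>\<and> \<beta>)))"
| Ax4: "nbI_axiom ((\<alpha> \<^bold>\<and> \<beta>) \<^bold>\<rightarrow> \<alpha>)"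
| Ax5: "nbI_axiom ((\<alpha> \<^bold>\<and> \<beta>) \<^bold>\<rightarrow> \<beta>)"
| Ax6: "nbI_axiom (\<alpha> \<^bold>\<rightarrow> (\<alpha> \<^bold>\<or> \<beta>))"
| Ax7: "nbI_axiom (\<beta> \<^bold>\<rightarrow> (\<alpha> \<^bold>\<or> \<beta>))"
| Ax8: "nbI_axiom ((\<alpha> \<^bold>\<rightarrow> \<gamma>) \<^bold>\<rightarrow> ((\<beta> \<^bold>\<rightarrow> \<gamma>) \<^bold>\<rightarrow> ((\<alpha> \<^bold>\<or> \<beta>) \<^bold>\<rightarrow> \<gamma>)))"
| Ax9: "nbI_axiom ((\<alpha> \<^bold>\<rightarrow> \<beta>) \<^bold>\<or> \<alpha>)"
| Ip: "nbI_axiom ((\<alpha> \<^bold>\<up> \<beta>) \<^bold>\<rightarrow> (\<alpha> \<^bold>\<rightarrow> (\<beta> \<^bold>\<rightarrow> \<gamma>)))"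
| Comm: "nbI_axiom ((\<alpha> \<^bold>\<up> \<beta>) \<^bold>\<rightarrow> (\<beta> \<^bold>\<up> \<alpha>))"
| Ax11: "nbI_axiom (\<alpha> \<^bold>\<or> \<^bold>\<not> \<alpha>)"

datatype nbI_ext = nbIciw | nbIci | nbIcl

inductive ext_axiom :: "nbI_ext \<Rightarrow> 'v fm \<Rightarrow> bool" where
  ciw: "ext_axiom nbIciw ((\<alpha> \<^bold>\<up> \<^bold>\<not> \<alpha>) \<^bold>\<or> (\<alpha> \<^bold>\<and> \<^bold>\<not> \<alpha>))"
| ci: "ext_axiom nbIci (\<^bold>\<not> (\<alpha> \<^bold>\<up> \<^bold>\<not> \<alpha>) \<^bold>\<rightarrow> (\<alpha> \<^bold>\<and> \<^bold>\<not> \<alpha>))"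
| cl: "ext_axiom nbIcl (\<^bold>\<not> (\<alpha> \<^bold>\<and> \<^bold>\<not> \<alpha>) \<^bold>\<rightarrow> (\<alpha> \<^bold>\<up> \<^bold>\<not> \<alpha>))"

definition derivation :: "nbI_ext \<Rightarrow> 'v fm set \<Rightarrow> 'v fm list \<Rightarrow> bool" where
  "derivation L \<Gamma> ds \<longleftrightarrow>
     (\<forall>i < length ds.
        ds ! i \<in> \<Gamma> \<or> nbI_axiom (ds ! i) \<or> ext_axiom L (ds ! i) \<or>
        (\<exists>j < i. \<exists>k < i. ds ! k = (ds ! j \<^bold>\<rightarrow> ds ! i)))"

definition derives :: "'v fm set \<Rightarrow> nbI_ext \<Rightarrow> 'v fm \<Rightarrow> bool"
    (\<open>(_ \<turnstile>\<^bsub>_\<^esub> _)\<close> [51, 0, 51] 50) where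
  "\<Gamma> \<turnstile>\<^bsub>L\<^esub> \<phi> \<longleftrightarrow> (\<exists>ds. derivation L \<Gamma> ds \<and> ds \<noteq> [] \<and> last ds = \<phi>)"

text \<open>The truth values 1 and 0 are rendered as \<open>True\<close> and \<open>False\<close>.\<close>

definition nbI_bivaluation :: "('v fm \<Rightarrow> bool) \<Rightarrow> bool" where
  "nbI_bivaluation \<nu> \<longleftrightarrow>
     (\<forall>\<alpha> \<beta>.
        (\<nu> (\<alpha> \<^bold>\<or> \<beta>) \<longleftrightarrow> \<nu> \<alpha> \<or> \<nu> \<beta>) \<and>
        (\<nu> (\<alpha> \<^bold>\<and> \<beta>) \<longleftrightarrow> \<nu> \<alpha> \<and> \<nu> \<beta>) \<and>
        (\<nu> (\<alpha> \<^bold>\<rightarrow> \<beta>) \<longleftrightarrow> \<not> \<nu> \<alpha> \<or> \<nu> \<beta>) \<and>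
        (\<nu> (\<alpha> \<^bold>\<up> \<beta>) \<longrightarrow> \<not> \<nu> \<alpha> \<or> \<not> \<nu> \<beta>) \<and>
        (\<nu> (\<alpha> \<^bold>\<up> \<beta>) \<longleftrightarrow> \<nu> (\<beta> \<^bold>\<up> \<alpha>)) \<and>
        (\<not> \<nu> (\<^bold>\<not> \<alpha>) \<longrightarrow> \<nu> \<alpha>))"

definition bivaluation :: "nbI_ext \<Rightarrow> ('v fm \<Rightarrow> bool) \<Rightarrow> bool" where
  "bivaluation L \<nu> \<longleftrightarrow>
     nbI_bivaluation \<nu> \<and>
     (\<forall>\<alpha>. \<not> \<nu> (\<alpha> \<^bold>\<up> \<^bold>\<not> \<alpha>) \<longrightarrow> \<nu> \<alpha> \<and> \<nu> (\<^bold>\<not> \<alpha>)) \<and>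
     (L = nbIci \<longrightarrow> (\<forall>\<alpha>. \<nu> (\<^bold>\<not> (\<alpha> \<^bold>\<up> \<^bold>\<not> \<alpha>)) \<longrightarrow> \<nu> \<alpha> \<and> \<nu> (\<^bold>\<not> \<alpha>))) \<and>
     (L = nbIcl \<longrightarrow> (\<forall>\<alpha>. \<nu> (\<^bold>\<not> (\<alpha> \<^bold>\<and> \<^bold>\<not> \<alpha>)) \<longrightarrow> \<nu> (\<alpha> \<^bold>\<up> \<^bold>\<not> \<alpha>)))"

definition entails :: "'v fm set \<Rightarrow> nbI_ext \<Rightarrow> 'v fm \<Rightarrow> bool"
    (\<open>(_ \<Turnstile>\<^bsub>_\<^esub> _)\<close> [51, 0, 51] 50) where
  "\<Gamma> \<Turnstile>\<^bsub>L\<^esub> \<phi> \<longleftrightarrow> (\<forall>\<nu>. bivaluation L \<nu> \<longrightarrow> (\<forall>\<gamma>\<in>\<Gamma>. \<nu> \<gamma>) \<longrightarrow> \<nu> \<phi>)"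

end

theory Submission
  imports Defs
begin

text \<open>
  Soundness holds because every axiom is true under every bivaluation, and a bivaluation reads
  the arrow classically, so Modus Ponens preserves truth. Hence every line of a derivation is
  true as soon as the premises are. The real content is the agreement between each axiom beyond
  the positive classical ones and a clause on bivaluations: Ip and Comm reflect the two clauses
  on \<open>\<^bold>\<up>\<close>, excluded middle reflects the clause on negation, and the axiom characteristic of each
  extension reflects one of the clauses that its bivaluations satisfy.
\<close>

lemma nbI_bivaluation_clauses:
  assumes "nbI_bivaluation \<nu>"
  shows nbI_bivaluation_Or: "\<nu> (\<alpha> \<^bold>\<or> \<beta>) \<longleftrightarrow> \<nu> \<alpha> \<or> \<nu> \<beta>"
    and nbI_bivaluation_And: "\<nu> (\<alpha> \<^bold>\<and> \<beta>) \<longleftrightarrow> \<nu> \<alpha> \<and> \<nu> \<beta>"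
    and nbI_bivaluation_Imp: "\<nu> (\<alpha> \<^bold>\<rightarrow> \<beta>) \<longleftrightarrow> (\<nu> \<alpha> \<longrightarrow> \<nu> \<beta>)"
    and nbI_bivaluation_incompatible: "\<nu> (\<alpha> \<^bold>\<up> \<beta>) \<longrightarrow> \<not> (\<nu> \<alpha> \<and> \<nu> \<beta>)"
    and nbI_bivaluation_Inc_commute: "\<nu> (\<alpha> \<^bold>\<up> \<beta>) \<longleftrightarrow> \<nu> (\<beta> \<^bold>\<up> \<alpha>)"
    and nbI_bivaluation_excluded_middle: "\<nu> \<alpha> \<or> \<nu> (\<^bold>\<not> \<alpha>)"
  using assms[unfolded nbI_bivaluation_def, THEN spec, THEN spec, of \<alpha> \<beta>] by argo+

lemma nbI_axiom_true:
  assumes "nbI_axiom \<phi>" and "nbI_bivaluation \<nu>"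
  shows "\<nu> \<phi>"
proof -
  note connectives = nbI_bivaluation_Or[OF assms(2)] nbI_bivaluation_And[OF assms(2)]
    nbI_bivaluation_Imp[OF assms(2)]
  from assms(1) show ?thesis
  proof cases
    case (Ip \<alpha> \<beta> \<gamma>)
    then show ?thesis
      using nbI_bivaluation_incompatible[OF assms(2), of \<alpha> \<beta>] by (simp add: connectives)
  next
    case (Comm \<alpha> \<beta>)
    then show ?thesis
      using nbI_bivaluation_Inc_commute[OF assms(2), of \<alpha> \<beta>] by (simp add: connectives)
  next
    case (Ax11 \<alpha>)
    then show ?thesis
      using nbI_bivaluation_excluded_middle[OF assms(2), of \<alpha>] by (simp add: connectives)
  qed (simp_all add: connectives)
qed

text \<open>
  For nbIciw the disjunction is the shared clause, that \<open>\<nu> (\<alpha> \<^bold>\<up> \<^bold>\<not> \<alpha>)\<close> fails only if both \<open>\<alpha>\<close>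
  and \<open>\<^bold>\<not> \<alpha>\<close> are true. The axioms of nbIci and nbIcl are implications from a negation, whose value
  the value of the negated formula leaves open when that formula is true; this is why each of them
  has a clause stated for the negated formula itself.
\<close>

lemma ext_axiom_true:
  assumes "ext_axiom L \<phi>" and "bivaluation L \<nu>"
  shows "\<nu> \<phi>"
proof -
  have nbI: "nbI_bivaluation \<nu>"
    using assms(2) by (simp add: bivaluation_def)
  note connectives = nbI_bivaluation_Or[OF nbI] nbI_bivaluation_And[OF nbI]
    nbI_bivaluation_Imp[OF nbI]
  from assms(1) show ?thesis
  proof cases
    case (ciw \<alpha>)
    then show ?thesis
      using assms(2) unfolding bivaluation_def by (metis connectives)
  next
    case (ci \<alpha>)
    then show ?thesis
      using assms(2) unfolding bivaluation_def by (metis connectives)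
  next
    case (cl \<alpha>)
    then show ?thesis
      using assms(2) unfolding bivaluation_def by (metis connectives)
  qed
qed

lemma derivation_line_true:
  assumes deriv: "derivation L \<Gamma> ds" and biv: "bivaluation L \<nu>"
    and prem: "\<forall>\<gamma>\<in>\<Gamma>. \<nu> \<gamma>"
  shows "i < length ds \<Longrightarrow> \<nu> (ds ! i)"
proof (induction i rule: less_induct)
  case (less i)
  have nbI: "nbI_bivaluation \<nu>"
    using biv by (simp add: bivaluation_def)
  consider "ds ! i \<in> \<Gamma>" | "nbI_axiom (ds ! i)" | "ext_axiom L (ds ! i)"
    | (MP) j k where "j < i" "k < i" "ds ! k = (ds ! j \<^bold>\<rightarrow> ds ! i)"
    using deriv less.prems unfolding derivation_def by blast
  then show ?case
  proof cases
    case MP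
    then have "\<nu> (ds ! j)" and "\<nu> (ds ! j \<^bold>\<rightarrow> ds ! i)"
      using less.IH[of j] less.IH[of k] less.prems by auto
    then show ?thesis
      by (simp add: nbI_bivaluation_Imp[OF nbI])
  qed (use prem biv nbI nbI_axiom_true ext_axiom_true in blast)+
qed

theorem theorem9:
  fixes L :: nbI_ext and \<Gamma> :: "'v::countable fm set" and \<phi> :: "'v fm"
  assumes "\<Gamma> \<turnstile>\<^bsub>L\<^esub> \<phi>"
  shows "\<Gamma> \<Turnstile>\<^bsub>L\<^esub> \<phi>"
proof -
  obtain ds where deriv: "derivation L \<Gamma> ds" and "ds \<noteq> []" and "last ds = \<phi>"
    using assms by (auto simp: derives_def)
  then have last_line: "length ds - 1 < length ds" "ds ! (length ds - 1) = \<phi>"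
    by (auto simp: last_conv_nth)
  show ?thesis
    unfolding entails_def
  proof (intro allI impI)
    fix \<nu> assume "bivaluation L \<nu>" and "\<forall>\<gamma>\<in>\<Gamma>. \<nu> \<gamma>"
    then show "\<nu> \<phi>"
      using derivation_line_true[OF deriv _ _ last_line(1), of \<nu>] last_line(2) by simp
  qed
qed

end
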